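(* Let $\|\cdot\|$ be a norm on $\mathbb{R}^2$ whose unit circle contains an arc of positive length that is contained in a Euclidean ($L^2$) circle centered at the origin. Then for each $n\in\mathbb{N}$ there exist infinitely many (after scaling and translating) line-like configurations of size $n$ in $\|\cdot\|$.
   Context: The unit circle of a norm is the boundary of its unit ball. A set $S\subset\mathbb{R}^2$ of $n$ points is a line-like configuration of size $n$ in $\|\cdot\|$ if its distance graph is isomorphic to that of $n$ equally spaced points on a line, i.e. there is a bijection $\phi: S\to\{1,\dots,n\}$ such that for all $a,b,c,d\in S$: $\|a-b\|=\|c-d\|$ if and only if $|\phi(a)-\phi(b)|=|\phi(c)-\phi(d)|$. "Infinitely many (after scaling and translating)" means that there are infinitely many such sets no two of which are related by a map $p\mapsto \lambda p+v$ with $\lambda>0$, $v\in\mathbb{R}^2$.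
   Formalization: The claim is stated for n ≥ 2 instead of every n, since for n = 1 all configurations are single points, which are translates of one another (and for n = 0 only the empty set occurs), so there are not infinitely many after scaling and translating. *)

theory Defs
  imports "HOL-Analysis.Analysis"
begin

(* The library's norm is a fixed type-class operation (Euclidean on real^2), so an arbitrary
   norm on real^2 is a function satisfying the norm axioms. *)
definition is_norm :: "('a::real_vector \<Rightarrow> real) \<Rightarrow> bool" where
  "is_norm N \<longleftrightarrow>
     (\<forall>x. 0 \<le> N x) \<and>
     (\<forall>x. N x = 0 \<longleftrightarrow> x = 0) \<and>
     (\<forall>c x. N (c *\<^sub>R x) = \<bar>c\<bar> * N x) \<and>
     (\<forall>x y. N (x + y) \<le> N x + N y)"

definition unit_circle :: "(real^2 \<Rightarrow> real) \<Rightarrow> (real^2) set" where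
  "unit_circle N = frontier {x. N x \<le> 1}"

(* An arc in the library sense is an injective path on [0,1]; it has two distinct endpoints,
   so it automatically has positive length.  The sphere is the Euclidean one. *)
definition contains_euclidean_arc :: "(real^2 \<Rightarrow> real) \<Rightarrow> bool" where
  "contains_euclidean_arc N \<longleftrightarrow>
     (\<exists>g r. arc g \<and> 0 < r \<and> path_image g \<subseteq> unit_circle N \<and> path_image g \<subseteq> sphere 0 r)"

definition line_like :: "(real^2 \<Rightarrow> real) \<Rightarrow> nat \<Rightarrow> (real^2) set \<Rightarrow> bool" where
  "line_like N n S \<longleftrightarrow>
     finite S \<and> card S = n \<and>
     (\<exists>\<phi>::real^2 \<Rightarrow> nat. bij_betw \<phi> S {1..n} \<and>
        (\<forall>a\<in>S. \<forall>b\<in>S. \<forall>c\<in>S. \<forall>d\<in>S.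
           N (a - b) = N (c - d) \<longleftrightarrow>
           \<bar>int (\<phi> a) - int (\<phi> b)\<bar> = \<bar>int (\<phi> c) - int (\<phi> d)\<bar>))"

definition scaled_translate :: "(real^2) set \<Rightarrow> (real^2) set \<Rightarrow> bool" where
  "scaled_translate S T \<longleftrightarrow> (\<exists>c>0. \<exists>v. T = (\<lambda>p. c *\<^sub>R p + v) ` S)"

definition infinitely_many_up_to_scaling_translating :: "((real^2) set \<Rightarrow> bool) \<Rightarrow> bool" where
  "infinitely_many_up_to_scaling_translating P \<longleftrightarrow>
     (\<exists>F. infinite F \<and> (\<forall>S\<in>F. P S) \<and>
          (\<forall>S\<in>F. \<forall>T\<in>F. S \<noteq> T \<longrightarrow> \<not> scaled_translate S T))"

end

theory Submission
  imports Defs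
begin

text \<open>
  On the directions met by the arc the norm is a multiple of the Euclidean one.  The differences of
  points on a Euclidean circle at angles \<open>\<alpha> - \<pi>/2 + k \<delta>\<close> are chords, with directions
  \<open>\<alpha> + (j + k) \<delta> / 2\<close> and Euclidean lengths \<open>2 \<bar>sin ((j - k) \<delta> / 2)\<bar>\<close>.  If \<open>\<delta>\<close> is small, all these
  directions are met by the arc, so the norm of a difference is a strictly increasing function of
  \<open>\<bar>j - k\<bar>\<close>.  The extreme direction \<open>\<alpha> + 3 \<delta> / 2\<close> of a chord is invariant under scaling and
  translating and tells different \<open>\<delta>\<close> apart.
\<close>

section \<open>Unit vectors and chords of the Euclidean circle\<close>

definition unit_vec :: "real \<Rightarrow> real^2" where
  "unit_vec t = vector [cos t, sin t]"

lemma unit_vec_nth [simp]: "unit_vec t $ 1 = cos t" "unit_vec t $ 2 = sin t"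
  by (simp_all add: unit_vec_def)

text \<open>Sum-to-product formulas. A chord is perpendicular to the radius at the mean angle; the
  shift by pi/2 cancels this right angle, so the direction becomes the mean of \<open>s\<close> and
  \<open>t\<close> itself.\<close>

lemma unit_vec_diff:
  "unit_vec (s - pi/2) - unit_vec (t - pi/2) = (2 * sin ((s - t)/2)) *\<^sub>R unit_vec ((s + t)/2)"
  by (simp add: vec_eq_iff forall_2 cos_diff sin_diff sin_diff_sin cos_diff_cos minus_divide_left add.commute)

text \<open>The planar cross product with \<open>unit_vec t\<close> kills the right-hand vector and
  turns the left-hand one into \<open>c * sin (t - s)\<close>.\<close>

lemma unit_vec_parallel:
  assumes "c *\<^sub>R unit_vec s = d *\<^sub>R unit_vec t" "c \<noteq> 0"
  shows "sin (t - s) = 0"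
proof -
  have *: "c * cos s = d * cos t" "c * sin s = d * sin t"
    using assms(1) by (auto simp: vec_eq_iff forall_2)
  have "c * sin (t - s) = sin t * (c * cos s) - cos t * (c * sin s)"
    by (simp add: sin_diff algebra_simps)
  also have "\<dots> = 0"
    by (simp add: *)
  finally show ?thesis
    using assms(2) by simp
qed

section \<open>From the unit circle of the norm to a sector of directions\<close>

lemma is_norm_continuous_on:
  fixes N :: "'a::euclidean_space \<Rightarrow> real"
  assumes "is_norm N"
  shows "continuous_on UNIV N"
proof (rule convex_on_continuous)
  show "convex_on UNIV N"
  proof (rule convex_onI)
    fix t x y assume "0 < t" "t < (1::real)"
    have "N ((1 - t) *\<^sub>R x + t *\<^sub>R y) \<le> N ((1 - t) *\<^sub>R x) + N (t *\<^sub>R y)"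
      using assms unfolding is_norm_def by blast
    also have "\<dots> = (1 - t) * N x + t * N y"
      using assms \<open>0 < t\<close> \<open>t < 1\<close> by (simp add: is_norm_def)
    finally show "N ((1 - t) *\<^sub>R x + t *\<^sub>R y) \<le> (1 - t) * N x + t * N y" .
  qed simp
qed simp

text \<open>By continuity the unit ball is closed and the set where \<open>N x < 1\<close> lies in
  its interior, so only the value 1 is left on the frontier.\<close>

lemma unit_circle_eq_1:
  assumes "is_norm N" "x \<in> unit_circle N"
  shows "N x = 1"
proof -
  note cont = is_norm_continuous_on[OF assms(1)]
  have "closed {x. N x \<le> 1}"
    by (intro closed_Collect_le cont continuous_intros)
  moreover have "open {x. N x < 1}"
    by (intro open_Collect_less cont continuous_intros)
  then have "{x. N x < 1} \<subseteq> interior {x. N x \<le> 1}"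
    by (intro interior_maximal) auto
  ultimately show ?thesis
    using assms(2) by (force simp: unit_circle_def frontier_def)
qed

text \<open>The polar angle is lifted to a continuous function along the arc; its values form a
  connected set with more than one element, which contains an interval.\<close>

lemma arc_on_sphere_contains_sector:
  fixes g :: "real \<Rightarrow> real^2"
  assumes "arc g" "path_image g \<subseteq> sphere 0 r" "0 < r"
  obtains a b where "a < b" "\<And>t. t \<in> {a..b} \<Longrightarrow> r *\<^sub>R unit_vec t \<in> path_image g"
proof -
  define f where "f t = Complex (g t $ 1) (g t $ 2)" for t
  have g: "continuous_on {0..1} g"
    using assms(1) by (simp add: arc_def path_def)
  have norm_f: "norm (f t) = r" if "t \<in> {0..1}" for t
  proof -
    have "norm (g t) = r"
      using assms(2) that by (force simp: path_image_def)
    then show ?thesis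
      by (simp add: f_def cmod_def norm_vec_def L2_set_def sum_2)
  qed
  have "continuous_on (cbox 0 1) f"
    using g unfolding f_def Complex_eq by (auto intro!: continuous_intros)
  moreover have "f t \<noteq> 0" if "t \<in> cbox 0 1" for t
    using norm_f[of t] that assms(3) by auto
  \<comment> \<open>A continuous logarithm exists because the parameter interval is contractible and
    \<open>f\<close> avoids 0. Its real part is constantly \<open>ln r\<close>, and its imaginary
    part is the lifted angle.\<close>
  ultimately obtain h where h: "continuous_on (cbox 0 1) h" "\<And>t. t \<in> cbox 0 1 \<Longrightarrow> f t = exp (h t)"
    using continuous_logarithm_on_contractible convex_imp_contractible convex_box(1) by metis
  have g_eq: "g t = r *\<^sub>R unit_vec (Im (h t))" if t: "t \<in> {0..1}" for t
  proof -
    have "f t = exp (h t)"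
      using h(2) t by simp
    moreover have "exp (Re (h t)) = r"
      using norm_f[OF t] h(2)[of t] t by (simp add: norm_exp_eq_Re)
    ultimately have "f t = of_real r * cis (Im (h t))"
      by (simp add: exp_eq_polar)
    then show ?thesis
      by (simp add: f_def complex_eq_iff vec_eq_iff forall_2)
  qed
  define A where "A = (\<lambda>t. Im (h t)) ` {0..1}"
  have "connected A"
    unfolding A_def using h(1) by (intro connected_continuous_image continuous_intros) auto
  have "g 0 \<noteq> g 1"
    using arc_distinct_ends[OF assms(1)] by (simp add: pathstart_def pathfinish_def)
  then have "Im (h 0) \<noteq> Im (h 1)"
    using g_eq[of 0] g_eq[of 1] by auto
  moreover have "Im (h 0) \<in> A" "Im (h 1) \<in> A"
    by (auto simp: A_def)
  ultimately obtain a b where ab: "a \<in> A" "b \<in> A" "a < b"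
    by (metis linorder_neqE)
  show ?thesis
  proof (rule that[OF ab(3)])
    fix t assume "t \<in> {a..b}"
    then have "t \<in> A"
      using connected_contains_Icc[OF \<open>connected A\<close> ab(1,2)] by auto
    then show "r *\<^sub>R unit_vec t \<in> path_image g"
      using g_eq by (force simp: A_def path_image_def)
  qed
qed

section \<open>Equally spaced points on a circle form a line-like configuration\<close>

definition circle_point :: "real \<Rightarrow> real \<Rightarrow> nat \<Rightarrow> real^2" where
  "circle_point a d k = unit_vec (a + real k * d - pi/2)"

lemma circle_point_diff:
  "circle_point a d j - circle_point a d k =
     (2 * sin ((real j - real k) * d / 2)) *\<^sub>R unit_vec (a + (real j + real k) * d / 2)"
proof -
  have "((a + real j * d) - (a + real k * d)) / 2 = (real j - real k) * d / 2"
    "((a + real j * d) + (a + real k * d)) / 2 = a + (real j + real k) * d / 2"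
    by (simp_all add: field_simps)
  then show ?thesis
    by (simp only: circle_point_def unit_vec_diff)
qed

text \<open>The mean index is at most \<open>n\<close>, so the direction of the chord stays in the
  sector, where the norm of a unit vector is \<open>m\<close>. The bound by pi keeps the sine
  nonnegative, which removes the absolute value that homogeneity produces.\<close>

lemma norm_circle_point_diff:
  assumes N: "is_norm N" "\<And>t. t \<in> {a..b} \<Longrightarrow> N (unit_vec t) = m"
    and d: "0 < d" "real n * d \<le> b - a" "real n * d \<le> pi"
    and jk: "j \<le> n" "k \<le> n"
  shows "N (circle_point a d j - circle_point a d k) = 2 * sin (\<bar>real j - real k\<bar> * d / 2) * m"
proof -
  have "real i * d \<le> b - a" if "i \<le> n" for i
    using d(1,2) that by (meson less_imp_le mult_right_mono of_nat_le_iff order_trans)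
  from this[OF jk(1)] this[OF jk(2)] have "(real j + real k) * d \<le> 2 * (b - a)"
    by (simp add: distrib_right)
  moreover have "0 \<le> (real j + real k) * d"
    using d(1) by simp
  ultimately have "a + (real j + real k) * d / 2 \<in> {a..b}"
    by (simp add: field_simps)
  then have *: "N (unit_vec (a + (real j + real k) * d / 2)) = m"
    by (rule N(2))
  have "\<bar>real j - real k\<bar> * d \<le> real n * d"
    using d jk by (intro mult_right_mono) auto
  moreover have "0 \<le> \<bar>real j - real k\<bar> * d"
    using d by simp
  ultimately have "0 \<le> sin (\<bar>real j - real k\<bar> * d / 2)"
    using d(3) pi_gt_zero by (intro sin_ge_zero) linarith+
  moreover have "\<bar>sin ((real j - real k) * d / 2)\<bar> = \<bar>sin (\<bar>real j - real k\<bar> * d / 2)\<bar>"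
    by (smt (verit) mult_minus_left minus_divide_left sin_minus)
  ultimately show ?thesis
    using N(1) * by (simp add: circle_point_diff is_norm_def abs_mult)
qed

lemma line_like_circle_points:
  assumes N: "is_norm N" "\<And>t. t \<in> {a..b} \<Longrightarrow> N (unit_vec t) = m" and "0 < m"
    and d: "0 < d" "real n * d \<le> b - a" "real n * d \<le> pi"
  shows "line_like N n (circle_point a d ` {1..n})"
proof -
  let ?p = "circle_point a d"
  have dist_iff: "N (?p i - ?p j) = N (?p k - ?p l) \<longleftrightarrow>
      \<bar>int i - int j\<bar> = \<bar>int k - int l\<bar>"
    if "i \<le> n" "j \<le> n" "k \<le> n" "l \<le> n" for i j k l
  proof -
    \<comment> \<open>The range on which sine is injective: equal chord lengths then force equal
      index gaps.\<close>
    have half: "\<bar>real i - real j\<bar> * d / 2 \<in> {- (pi/2)..pi/2}" if "i \<le> n" "j \<le> n" for i j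
    proof -
      have "\<bar>real i - real j\<bar> * d \<le> real n * d"
        using d that by (intro mult_right_mono) auto
      moreover have "0 \<le> \<bar>real i - real j\<bar> * d / 2"
        using d by simp
      ultimately show ?thesis
        unfolding atLeastAtMost_iff using d(3) pi_gt_zero by (intro conjI) linarith+
    qed
    have eq: "N (?p i - ?p j) = 2 * sin (\<bar>real i - real j\<bar> * d / 2) * m"
      if "i \<le> n" "j \<le> n" for i j
      using N(2) by (rule norm_circle_point_diff[OF N(1) _ d that])
    have "N (?p i - ?p j) = N (?p k - ?p l) \<longleftrightarrow>
        sin (\<bar>real i - real j\<bar> * d / 2) = sin (\<bar>real k - real l\<bar> * d / 2)"
      using \<open>0 < m\<close> by (simp add: eq[OF that(1,2)] eq[OF that(3,4)])
    also have "\<dots> \<longleftrightarrow> \<bar>real i - real j\<bar> * d / 2 = \<bar>real k - real l\<bar> * d / 2"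
      using half[OF that(1,2)] half[OF that(3,4)] by (auto dest: sin_inj_pi[rotated 4])
    also have "\<dots> \<longleftrightarrow> \<bar>real i - real j\<bar> = \<bar>real k - real l\<bar>"
      using d by simp
    also have "\<dots> \<longleftrightarrow> \<bar>int i - int j\<bar> = \<bar>int k - int l\<bar>"
      by linarith
    finally show ?thesis .
  qed
  \<comment> \<open>Comparison with the zero distance from a point to itself: coinciding points have
    index gap 0.\<close>
  have inj: "inj_on ?p {1..n}"
  proof (rule inj_onI)
    fix j k assume "j \<in> {1..n}" "k \<in> {1..n}" "?p j = ?p k"
    then show "j = k"
      using dist_iff[of j k j j] by simp
  qed
  then have bij: "bij_betw (inv_into {1..n} ?p) (?p ` {1..n}) {1..n}"
    by (intro bij_betw_inv_into) (simp add: bij_betw_def)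
  show ?thesis
    unfolding line_like_def
    by (intro conjI exI[of _ "inv_into {1..n} ?p"] bij)
      (auto simp: card_image[OF inj] inv_into_f_f[OF inj] dist_iff simp del: One_nat_def)
qed

section \<open>Telling configurations with different steps apart\<close>

lemma scaled_translate_sym:
  assumes "scaled_translate S T"
  shows "scaled_translate T S"
proof -
  obtain c v where c: "0 < c" "T = (\<lambda>p. c *\<^sub>R p + v) ` S"
    using assms by (auto simp: scaled_translate_def)
  then have "S = (\<lambda>p. inverse c *\<^sub>R p + (- inverse c *\<^sub>R v)) ` T"
    by (simp add: image_image algebra_simps)
  then show ?thesis
    unfolding scaled_translate_def using c(1) positive_imp_inverse_positive by blast
qed

text \<open>The chord from point 1 to point 2 has angle \<open>a + 3 * d / 2\<close>. Its image
  would be a parallel chord of the other configuration, but all chords there have angles from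
  \<open>a + 3 * e / 2\<close> up to less than \<open>a + pi\<close>.\<close>

lemma not_scaled_translate_circle_points:
  assumes "2 \<le> n" "0 < d" "d < e" "real n * e < pi"
  shows "\<not> scaled_translate (circle_point a d ` {1..n}) (circle_point a e ` {1..n})"
proof
  assume "scaled_translate (circle_point a d ` {1..n}) (circle_point a e ` {1..n})"
  then obtain c v where "0 < c"
    and im: "circle_point a e ` {1..n} = (\<lambda>p. c *\<^sub>R p + v) ` circle_point a d ` {1..n}"
    by (auto simp: scaled_translate_def)
  have "c *\<^sub>R circle_point a d k + v \<in> circle_point a e ` {1..n}" if "k \<in> {1..n}" for k
    using im that by auto
  from this[of 2] this[of 1] assms(1) obtain j k where
    j: "j \<in> {1..n}" "c *\<^sub>R circle_point a d 2 + v = circle_point a e j" and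
    k: "k \<in> {1..n}" "c *\<^sub>R circle_point a d 1 + v = circle_point a e k"
    by auto
  have "2 * e \<le> real n * e"
    using assms by (intro mult_right_mono) auto
  then have "0 < sin (d / 2)"
    using assms by (intro sin_gt_zero) linarith+
  have "c *\<^sub>R (circle_point a d 2 - circle_point a d 1) = circle_point a e j - circle_point a e k"
    unfolding j(2)[symmetric] k(2)[symmetric] by (simp add: algebra_simps)
  then have eq: "(c * (2 * sin (d / 2))) *\<^sub>R unit_vec (a + 3 * d / 2) =
      (2 * sin ((real j - real k) * e / 2)) *\<^sub>R unit_vec (a + (real j + real k) * e / 2)"
    by (simp add: circle_point_diff)
  moreover have nz: "c * (2 * sin (d / 2)) \<noteq> 0"
    using \<open>0 < c\<close> \<open>0 < sin (d / 2)\<close> by simp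
  ultimately have "sin ((a + (real j + real k) * e / 2) - (a + 3 * d / 2)) = 0"
    by (rule unit_vec_parallel)
  \<comment> \<open>The image chord is not degenerate; this raises the lower bound on
    \<open>j + k\<close> from 2 to 3.\<close>
  moreover have "j \<noteq> k"
  proof
    assume "j = k"
    then have "(c * (2 * sin (d / 2))) *\<^sub>R unit_vec (a + 3 * d / 2) = 0"
      using eq by simp
    then have "unit_vec (a + 3 * d / 2) = 0"
      using nz by simp
    then have "cos (a + 3 * d / 2) = 0" "sin (a + 3 * d / 2) = 0"
      by (metis unit_vec_nth zero_index)+
    then show False
      using sin_zero_abs_cos_one by fastforce
  qed
  then have "3 \<le> real j + real k" "real j + real k \<le> 2 * real n"
    using j(1) k(1) by auto
  then have "3 * e \<le> (real j + real k) * e" "(real j + real k) * e \<le> 2 * real n * e"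
    using assms by (auto intro: mult_right_mono)
  \<comment> \<open>The angle difference is at least \<open>3 * (e - d) / 2\<close> and less than
    \<open>real n * e\<close>, hence strictly between 0 and pi: the chords are not even
    antiparallel.\<close>
  then have "0 < sin ((a + (real j + real k) * e / 2) - (a + 3 * d / 2))"
    using assms by (intro sin_gt_zero) linarith+
  ultimately show False
    by simp
qed

theorem theorem1p3:
  fixes N :: "real^2 \<Rightarrow> real" and n :: nat
  assumes "is_norm N"
    and "contains_euclidean_arc N"
    and "2 \<le> n"
  shows "infinitely_many_up_to_scaling_translating (line_like N n)"
proof -
  obtain g r where g: "arc g" "0 < r" "path_image g \<subseteq> unit_circle N" "path_image g \<subseteq> sphere 0 r"
    using assms(2) by (auto simp: contains_euclidean_arc_def)
  obtain a b where ab: "a < b" "\<And>t. t \<in> {a..b} \<Longrightarrow> r *\<^sub>R unit_vec t \<in> path_image g"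
    using arc_on_sphere_contains_sector[OF g(1,4,2)] by metis
  \<comment> \<open>Homogeneity: a vector of the arc has Euclidean length \<open>r\<close> and value
    1 under \<open>N\<close>.\<close>
  have N_eq: "N (unit_vec t) = 1 / r" if "t \<in> {a..b}" for t
  proof -
    have "N (r *\<^sub>R unit_vec t) = 1"
      using unit_circle_eq_1[OF assms(1)] ab(2)[OF that] g(3) by blast
    then show ?thesis
      using assms(1) g(2) by (simp add: is_norm_def field_simps)
  qed
  \<comment> \<open>Every step below \<epsilon> keeps \<open>n\<close> steps shorter than both the
    sector and a half turn.\<close>
  define \<epsilon> where "\<epsilon> = min (b - a) pi / real n"
  define S where "S d = circle_point a d ` {1..n}" for d
  have "0 < \<epsilon>"
    using ab assms(3) by (simp add: \<epsilon>_def)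
  have small: "real n * d < b - a" "real n * d < pi" if "d < \<epsilon>" for d
    using that assms(3) by (auto simp: \<epsilon>_def field_simps)
  have distinct: "\<not> scaled_translate (S d) (S e)" if "d \<in> {0<..<\<epsilon>}" "e \<in> {0<..<\<epsilon>}" "d \<noteq> e" for d e
  proof (cases "d < e")
    case True
    then show ?thesis
      using not_scaled_translate_circle_points[OF assms(3)] small that by (auto simp: S_def)
  next
    case False
    then have "\<not> scaled_translate (S e) (S d)"
      using not_scaled_translate_circle_points[OF assms(3)] small that by (auto simp: S_def)
    then show ?thesis
      using scaled_translate_sym by blast
  qed
  have refl: "scaled_translate T T" for T
    unfolding scaled_translate_def by (intro exI[of _ 1] conjI exI[of _ 0]) auto
  \<comment> \<open>A set is a scaled translate of itself, so inequivalence for different steps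
    already makes the sets different.\<close>
  have "inj_on S {0<..<\<epsilon>}"
    by (intro inj_onI) (metis distinct refl)
  then have "infinite (S ` {0<..<\<epsilon>})"
    using \<open>0 < \<epsilon>\<close> by (simp add: finite_image_iff infinite_Ioo)
  moreover have "line_like N n (S d)" if "d \<in> {0<..<\<epsilon>}" for d
    unfolding S_def using g(2) that small[of d]
    by (intro line_like_circle_points[OF assms(1) N_eq]) auto
  moreover have "\<not> scaled_translate T U"
    if "T \<in> S ` {0<..<\<epsilon>}" "U \<in> S ` {0<..<\<epsilon>}" "T \<noteq> U" for T U
    using that distinct by blast
  ultimately show ?thesis
    unfolding infinitely_many_up_to_scaling_translating_def
    by (intro exI[of _ "S ` {0<..<\<epsilon>}"]) auto
qed

end
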